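(* The only core graphs on $6$ vertices (up to isomorphism) are $K_6$ and $C_5+1$, and these two graphs are projective.
   Context: Graphs are finite, simple, undirected, loopless. $C_5+1$ is the $5$-cycle together with one additional vertex adjacent to all five cycle vertices. $H$ is a core if every homomorphism $H\to H$ is bijective. A polymorphism $f:V_H^m\to V_H$ is a homomorphism from the $m$-fold direct product $H^m$ to $H$; it is idempotent if $f(x,\dots,x)=x$. $H$ is projective if every idempotent polymorphism is a projection. *)

theory Defs
  imports "Graph_Theory.Graph_Theory"
begin

text \<open>
  A finite simple undirected loopless graph is a \<^typ>\<open>'a pair_pre_digraph\<close> satisfying
  \<^const>\<open>pair_graph\<close>; an undirected edge is represented by its two orientations.
\<close>

definition graph_hom :: "'a pair_pre_digraph \<Rightarrow> 'b pair_pre_digraph \<Rightarrow> ('a \<Rightarrow> 'b) \<Rightarrow> bool" where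
  "graph_hom G H f \<longleftrightarrow>
     (\<forall>v \<in> pverts G. f v \<in> pverts H) \<and> (\<forall>(u, v) \<in> parcs G. (f u, f v) \<in> parcs H)"

definition core :: "'a pair_pre_digraph \<Rightarrow> bool" where
  "core H \<longleftrightarrow> (\<forall>f. graph_hom H H f \<longrightarrow> bij_betw f (pverts H) (pverts H))"

text \<open>The direct product of \<open>m\<close> copies of \<open>H\<close>; an \<open>m\<close>-tuple is a list of length \<open>m\<close>.\<close>

definition direct_power :: "'a pair_pre_digraph \<Rightarrow> nat \<Rightarrow> 'a list pair_pre_digraph" where
  "direct_power H m =
     \<lparr> pverts = {xs. length xs = m \<and> set xs \<subseteq> pverts H},
       parcs = {(xs, ys). length xs = m \<and> length ys = m \<and> (\<forall>i < m. (xs ! i, ys ! i) \<in> parcs H)} \<rparr>"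

definition polymorphism :: "'a pair_pre_digraph \<Rightarrow> nat \<Rightarrow> ('a list \<Rightarrow> 'a) \<Rightarrow> bool" where
  "polymorphism H m f \<longleftrightarrow> graph_hom (direct_power H m) H f"

definition idempotent :: "'a pair_pre_digraph \<Rightarrow> nat \<Rightarrow> ('a list \<Rightarrow> 'a) \<Rightarrow> bool" where
  "idempotent H m f \<longleftrightarrow> (\<forall>x \<in> pverts H. f (replicate m x) = x)"

definition is_projection :: "'a pair_pre_digraph \<Rightarrow> nat \<Rightarrow> ('a list \<Rightarrow> 'a) \<Rightarrow> bool" where
  "is_projection H m f \<longleftrightarrow> (\<exists>i < m. \<forall>xs \<in> pverts (direct_power H m). f xs = xs ! i)"

definition projective :: "'a pair_pre_digraph \<Rightarrow> bool" where
  "projective H \<longleftrightarrow>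
     (\<forall>m \<ge> 1. \<forall>f. polymorphism H m f \<and> idempotent H m f \<longrightarrow> is_projection H m f)"

definition complete_graph :: "nat \<Rightarrow> nat pair_pre_digraph" where
  "complete_graph n = \<lparr> pverts = {..<n}, parcs = {(u, v). u < n \<and> v < n \<and> u \<noteq> v} \<rparr>"

definition cycle_graph :: "nat \<Rightarrow> nat pair_pre_digraph" where
  "cycle_graph n = \<lparr> pverts = {..<n},
     parcs = {(u, v). u < n \<and> v < n \<and> (v = Suc u mod n \<or> u = Suc v mod n)} \<rparr>"

text \<open>The graph \<open>G + 1\<close>: the additional vertex is \<^const>\<open>None\<close>.\<close>

definition add_universal_vertex :: "'a pair_pre_digraph \<Rightarrow> 'a option pair_pre_digraph" where
  "add_universal_vertex G = \<lparr> pverts = insert None (Some ` pverts G),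
     parcs = {(Some u, Some v) | u v. (u, v) \<in> parcs G}
       \<union> {(None, Some v) | v. v \<in> pverts G} \<union> {(Some v, None) | v. v \<in> pverts G} \<rparr>"

lemma complete_digraph_complete_graph: "complete_digraph n (with_proj (complete_graph n))"
  by (auto simp: complete_digraph_pair_def complete_graph_def)

lemma pair_graph_complete_graph: "pair_graph (complete_graph n)"
  using complete_digraph_complete_graph by (rule pair_graphI_complete)

lemma pair_graph_cycle_graph:
  assumes "n \<ge> 2"
  shows "pair_graph (cycle_graph n)"
proof
  have "parcs (cycle_graph n) \<subseteq> {..<n} \<times> {..<n}"
    by (auto simp: cycle_graph_def)
  then show "finite (parcs (cycle_graph n))"
    by (rule finite_subset) simp
  show "symmetric (with_proj (cycle_graph n))"
    by (auto simp: symmetric_def cycle_graph_def intro!: symI)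
next
  fix e assume "e \<in> parcs (cycle_graph n)"
  then show "fst e \<noteq> snd e"
    using assms by (auto simp: cycle_graph_def mod_Suc split: if_splits)
qed (auto simp: cycle_graph_def)

lemma pair_graph_add_universal_vertex:
  assumes "pair_graph G"
  shows "pair_graph (add_universal_vertex G)"
proof -
  interpret pair_graph G by fact
  show ?thesis
  proof
    have "parcs (add_universal_vertex G)
        \<subseteq> insert None (Some ` pverts G) \<times> insert None (Some ` pverts G)"
      by (auto simp: add_universal_vertex_def dest: in_arcsD1 in_arcsD2)
    then show "finite (parcs (add_universal_vertex G))"
      by (rule finite_subset) simp
    show "symmetric (with_proj (add_universal_vertex G))"
      using pair_sym_arcs by (auto simp: symmetric_def add_universal_vertex_def sym_def)
  qed (auto simp: add_universal_vertex_def dest: in_arcsD1 in_arcsD2 pair_no_loops)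
qed

end

theory Submission
  imports Defs
begin

text \<open>
  Projectivity: an idempotent polymorphism \<open>f\<close> of a complete graph on at least four vertices is
  conservative. Call a set \<open>S\<close> of coordinates decisive if \<open>f\<close> returns \<open>p\<close> on every tuple that is \<open>p\<close>
  on \<open>S\<close> and \<open>q\<close> elsewhere; it is enough to check one pair \<open>p \<noteq> q\<close>. The coordinates where a
  tuple \<open>x\<close> takes the value \<open>f x\<close> form a decisive set, and any two decisive sets meet, so a minimal
  decisive set is a singleton \<open>{i}\<close> and \<open>f\<close> is the projection to \<open>i\<close>. In the 5-cycle two vertices are
  distinct iff they are joined by a walk of length three, so on the rim of the wheel \<open>C\<^sub>5 + 1\<close> an
  idempotent polymorphism preserves disequality and is a projection there; adjacency with rim tuples
  forces the same projection everywhere.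

  Classification: a core that is not complete admits no colouring by one of its cliques. Trying to
  extend a clique vertex by vertex, the colouring can be blocked without producing a larger clique
  only for triangles, and then the obstruction is exactly the wheel. In the triangle-free case one
  also needs that no vertex neighbourhood of a core is contained in another one.
\<close>

section \<open>Operations preserving disequality\<close>

text \<open>Four values are what the argument consumes: three to separate disjoint sets of
  coordinates inside one tuple, and a fourth as the background of the two-valued tuples it is
  compared with.\<close>

lemma projection_of_neq_preserving:
  fixes g :: "('i \<Rightarrow> 'a) \<Rightarrow> 'a"
  assumes "finite I" and distinct: "distinct [a, b, c, d]" and V: "{a, b, c, d} \<subseteq> V"
    and range: "\<And>x. x ` I \<subseteq> V \<Longrightarrow> g x \<in> V"
    and neq: "\<And>x y. x ` I \<subseteq> V \<Longrightarrow> y ` I \<subseteq> V \<Longrightarrow> \<forall>i\<in>I. x i \<noteq> y i \<Longrightarrow> g x \<noteq> g y"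
    and idem: "\<And>v. v \<in> V \<Longrightarrow> g (\<lambda>_. v) = v"
  shows "\<exists>i\<in>I. \<forall>x. x ` I \<subseteq> V \<longrightarrow> g x = x i"
proof -
  define vec where "vec S p q i = (if i \<in> S then p else q)" for S :: "'i set" and p q :: 'a and i
  define decisive where
    "decisive S \<longleftrightarrow> (\<forall>p\<in>V. \<forall>q\<in>V. p \<noteq> q \<longrightarrow> g (vec S p q) = p)" for S
  have in_V: "vec S p q ` I \<subseteq> V" if "p \<in> V" "q \<in> V" for S p q
    using that by (auto simp: vec_def)
  \<comment> \<open>If \<open>g x\<close> were not an entry of \<open>x\<close>, then
    \<open>x\<close> and the constant tuple at \<open>g x\<close> would differ everywhere, while
    idempotency gives both the same value.\<close>
  have conservative: "g x \<in> x ` I" if x: "x ` I \<subseteq> V" for x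
  proof (rule ccontr)
    assume no: "g x \<notin> x ` I"
    have "g x \<noteq> g (\<lambda>_. g x)"
      using no by (intro neq) (use x range[OF x] in force)+
    then show False using idem range[OF x] by simp
  qed
  have two: "g (vec S p q) = p \<or> g (vec S p q) = q" if "p \<in> V" "q \<in> V" for S p q
    using conservative[OF in_V[OF that, of S]] by (auto simp: vec_def)
  \<comment> \<open>The two tuples differ on \<open>S\<close> (\<open>r\<close> against
    \<open>p\<close>) and off it (\<open>p\<close> against \<open>q\<close>), so the value
    \<open>p\<close> is excluded and conservativity leaves \<open>r\<close>.\<close>
  have shift: "g (vec S r p) = r" if "g (vec S p q) = p" "{p, q, r} \<subseteq> V" "p \<noteq> q" "r \<noteq> p" for S p q r
  proof -
    have "g (vec S r p) \<noteq> g (vec S p q)"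
      using that by (intro neq in_V) (auto simp: vec_def)
    then show ?thesis using two[of r p S] that by auto
  qed
  have decisiveI: "decisive S" if pq: "g (vec S p q) = p" "p \<in> V" "q \<in> V" "p \<noteq> q" for S p q
    unfolding decisive_def
  proof (intro ballI impI)
    fix r s assume rs: "r \<in> V" "s \<in> V" "r \<noteq> s"
    \<comment> \<open>Two shifts, \<open>(p', q')\<close> to \<open>(t, p')\<close> to
      \<open>(p', t)\<close>, replace the background value alone.\<close>
    have left: "g (vec S p' t) = p'" if "g (vec S p' q') = p'" "{p', q', t} \<subseteq> V" "p' \<noteq> q'" "t \<noteq> p'" for p' q' t
    proof -
      have "g (vec S t p') = t" using that by (intro shift[of S p' q']) auto
      then show ?thesis using that by (intro shift[of S t p']) auto
    qed
    show "g (vec S r s) = r"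
    proof (cases "r = p")
      case True
      then show ?thesis using left[of p q s] pq rs by auto
    next
      case False
      then have "g (vec S r p) = r" using shift[of S p q r] pq rs by auto
      then show ?thesis using left[of r p s] pq rs False by auto
    qed
  qed
  have level: "decisive {i. x i = g x}" if x: "x ` I \<subseteq> V" for x
  proof (rule ccontr)
    let ?P = "{i. x i = g x}"
    assume nd: "\<not> decisive ?P"
    obtain e where e: "e \<in> V" "e \<noteq> g x" using distinct V by (metis distinct_length_2_or_more insert_subset)
    \<comment> \<open>This tuple is the opposite of \<open>x\<close>: it takes the value
      \<open>g x\<close> exactly off \<open>?P\<close>, so it differs from \<open>x\<close>
      everywhere. Were \<open>?P\<close> not decisive, both would nevertheless have value
      \<open>g x\<close>.\<close>
    have "g (vec ?P e (g x)) = g x"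
      using two[of e "g x" ?P] decisiveI[of ?P e "g x"] nd e range[OF x] by auto
    moreover have "g (vec ?P e (g x)) \<noteq> g x"
      using e x range[OF x] by (intro neq in_V) (auto simp: vec_def)
    ultimately show False by simp
  qed
  have meet: "S \<inter> T \<inter> I \<noteq> {}" if ST: "decisive S" "decisive T" for S T
  proof
    assume disj: "S \<inter> T \<inter> I = {}"
    \<comment> \<open>Each of the three entries is ruled out as the value of \<open>x\<close> by a
      decisive tuple that has this value and differs from \<open>x\<close> on all of
      \<open>I\<close>.\<close>
    define x where "x i = (if i \<in> S then a else if i \<in> T then b else c)" for i
    have x: "x ` I \<subseteq> V" using V by (auto simp: x_def)
    have "g x \<noteq> g (vec S b d)" "g x \<noteq> g (vec T a d)" "g x \<noteq> g (vec S c d)"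
      using distinct V disj by (intro neq x in_V; auto simp: vec_def x_def)+
    moreover have "g (vec S b d) = b" "g (vec T a d) = a" "g (vec S c d) = c"
      using ST V distinct by (auto simp: decisive_def)
    moreover have "g x \<in> {a, b, c}"
      using conservative[OF x] by (auto simp: x_def split: if_splits)
    ultimately show False by auto
  qed
  have "decisive I"
    using conservative[OF in_V, of a b I] V distinct by (intro decisiveI[of I a b]) (auto simp: vec_def)
  then obtain S where S: "S \<subseteq> I" "decisive S" and
    minimal: "\<And>T. T \<subseteq> I \<Longrightarrow> decisive T \<Longrightarrow> card S \<le> card T"
    using ex_has_least_nat[of "\<lambda>S. S \<subseteq> I \<and> decisive S" I card] by blast
  obtain i where i: "i \<in> S" using meet[OF S(2) S(2)] by auto
  have "finite S" using S \<open>finite I\<close> finite_subset by blast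
  have "decisive {i}"
  proof (rule ccontr)
    assume ndi: "\<not> decisive {i}"
    \<comment> \<open>One of the three level sets must be decisive: \<open>S - {i}\<close> fails by
      minimality and \<open>- S\<close> because it misses \<open>S\<close>, so only
      \<open>{i}\<close> remains.\<close>
    define x where "x j = (if j = i then a else if j \<in> S then b else c)" for j
    have x: "x ` I \<subseteq> V" using V by (auto simp: x_def)
    have "{j. x j = a} = {i}" "{j. x j = b} = S - {i}" "{j. x j = c} = - S"
      using distinct i by (auto simp: x_def)
    moreover have "\<not> decisive (S - {i})"
      using minimal[of "S - {i}"] S i \<open>finite S\<close> card_Diff1_less[of S i] by auto
    moreover have "\<not> decisive (- S)" using meet[OF S(2), of "- S"] by auto
    moreover have "g x \<in> {a, b, c}"
      using conservative[OF x] by (auto simp: x_def split: if_splits)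
    ultimately show False using level[OF x] ndi by auto
  qed
  then have "i \<in> I \<and> g x = x i" if "x ` I \<subseteq> V" for x
    using meet[OF level[OF that], of "{i}"] by auto
  then show ?thesis using S i by auto
qed

lemma list_projection_of_neq_preserving:
  assumes "distinct [a, b, c, d]" and "{a, b, c, d} \<subseteq> V"
    and range: "\<And>xs. length xs = m \<Longrightarrow> set xs \<subseteq> V \<Longrightarrow> f xs \<in> V"
    and neq: "\<And>xs ys. length xs = m \<Longrightarrow> length ys = m \<Longrightarrow> set xs \<subseteq> V \<Longrightarrow> set ys \<subseteq> V \<Longrightarrow>
        \<forall>i<m. xs ! i \<noteq> ys ! i \<Longrightarrow> f xs \<noteq> f ys"
    and idem: "\<And>v. v \<in> V \<Longrightarrow> f (replicate m v) = v"
  shows "\<exists>i<m. \<forall>xs. length xs = m \<and> set xs \<subseteq> V \<longrightarrow> f xs = xs ! i"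
proof -
  have "\<exists>i\<in>{..<m}. \<forall>x. x ` {..<m} \<subseteq> V \<longrightarrow> f (map x [0..<m]) = x i"
  proof (rule projection_of_neq_preserving[OF _ assms(1,2)])
    show "f (map (\<lambda>_. v) [0..<m]) = v" if "v \<in> V" for v
      using idem[OF that] by (simp add: map_replicate_const)
    show "f (map x [0..<m]) \<noteq> f (map y [0..<m])"
      if "x ` {..<m} \<subseteq> V" "y ` {..<m} \<subseteq> V" "\<forall>i\<in>{..<m}. x i \<noteq> y i" for x y
      using that by (intro neq) (auto simp: image_subset_iff)
    show "f (map x [0..<m]) \<in> V" if "x ` {..<m} \<subseteq> V" for x
      using that by (intro range) (auto simp: image_subset_iff)
  qed simp
  then obtain i where i: "i < m" "\<And>x. x ` {..<m} \<subseteq> V \<Longrightarrow> f (map x [0..<m]) = x i" by auto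
  have "f xs = xs ! i" if "length xs = m" "set xs \<subseteq> V" for xs
  proof -
    have "f (map (\<lambda>j. xs ! j) [0..<m]) = xs ! i" using that by (intro i(2)) auto
    moreover have "map (\<lambda>j. xs ! j) [0..<m] = xs" using that(1) map_nth[of xs] by simp
    ultimately show ?thesis by simp
  qed
  then show ?thesis using i(1) by blast
qed

text \<open>Adjacency is disequality here, so a polymorphism preserves disequality;
  \<open>n \<ge> 4\<close> supplies the four values.\<close>

lemma projective_complete_graph:
  assumes "n \<ge> 4"
  shows "projective (complete_graph n)"
  unfolding projective_def
proof (intro allI impI, elim conjE)
  fix m and f :: "nat list \<Rightarrow> nat"
  assume f: "polymorphism (complete_graph n) m f" "idempotent (complete_graph n) m f"
  have "\<exists>i<m. \<forall>xs. length xs = m \<and> set xs \<subseteq> {..<n} \<longrightarrow> f xs = xs ! i"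
  proof (rule list_projection_of_neq_preserving[of 0 1 2 3])
    show "f xs \<in> {..<n}" if "length xs = m" "set xs \<subseteq> {..<n}" for xs
      using f that by (auto simp: polymorphism_def graph_hom_def direct_power_def complete_graph_def)
    show "f xs \<noteq> f ys" if "length xs = m" "length ys = m" "set xs \<subseteq> {..<n}" "set ys \<subseteq> {..<n}"
        "\<forall>i<m. xs ! i \<noteq> ys ! i" for xs ys
    proof -
      have "(xs, ys) \<in> parcs (direct_power (complete_graph n) m)"
        using that by (simp add: direct_power_def complete_graph_def subset_eq all_set_conv_all_nth)
      then show ?thesis
        using f(1) by (auto simp: polymorphism_def graph_hom_def complete_graph_def)
    qed
    show "f (replicate m v) = v" if "v \<in> {..<n}" for v
      using f(2) that by (auto simp: idempotent_def complete_graph_def)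
  qed (use assms in auto)
  then show "is_projection (complete_graph n) m f"
    by (auto simp: is_projection_def direct_power_def complete_graph_def)
qed

section \<open>The wheel\<close>

abbreviation (input) wheel5 :: "nat option pair_pre_digraph" where
  "wheel5 \<equiv> add_universal_vertex (cycle_graph 5)"

lemma pverts_wheel5: "pverts wheel5 = insert None (Some ` {..<5})"
  by (simp add: add_universal_vertex_def cycle_graph_def)

lemma parcs_wheel5 [simp]:
  "(None, None) \<notin> parcs wheel5"
  "(None, Some v) \<in> parcs wheel5 \<longleftrightarrow> v < 5"
  "(Some v, None) \<in> parcs wheel5 \<longleftrightarrow> v < 5"
  "(Some u, Some v) \<in> parcs wheel5 \<longleftrightarrow> (u, v) \<in> parcs (cycle_graph 5)"
  by (auto simp: add_universal_vertex_def cycle_graph_def)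

lemma less_5_cases: "(u::nat) < 5 \<longleftrightarrow> u = 0 \<or> u = 1 \<or> u = 2 \<or> u = 3 \<or> u = 4"
  by auto

lemma lessThan_5: "{..<5} = {0, 1, 2, 3, 4::nat}"
  by (auto simp: less_5_cases)

lemma parcs_cycle5:
  "parcs (cycle_graph 5) =
    {(0, 1), (1, 0), (1, 2), (2, 1), (2, 3), (3, 2), (3, 4), (4, 3), (4, 0), (0, 4)}"
proof -
  have "parcs (cycle_graph 5) =
      (\<lambda>u. (u, Suc u mod 5)) ` {..<5} \<union> (\<lambda>u. (Suc u mod 5, u)) ` {..<5}"
    by (auto simp: cycle_graph_def)
  then show ?thesis
    by (simp add: lessThan_5 insert_commute numeral_2_eq_2)
qed

text \<open>Three steps of +1 or -1 add up to +-1 or +-3, which are exactly the nonzero residues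
  modulo 5. The proof evaluates the threefold relational composition.\<close>

lemma cycle5_walk3_iff:
  "(\<exists>x y. (u, x) \<in> parcs (cycle_graph 5) \<and> (x, y) \<in> parcs (cycle_graph 5)
      \<and> (y, v) \<in> parcs (cycle_graph 5)) \<longleftrightarrow> u < 5 \<and> v < 5 \<and> u \<noteq> v"
proof -
  let ?E = "parcs (cycle_graph 5)" and ?V = "{0, 1, 2, 3, 4::nat}"
  have "?E O ?E O ?E = (SIGMA u : ?V. ?V - {u})"
    unfolding parcs_cycle5 by code_simp
  then have "(u, v) \<in> ?E O ?E O ?E \<longleftrightarrow> u < 5 \<and> v < 5 \<and> u \<noteq> v"
    unfolding lessThan_5[symmetric] by auto
  then show ?thesis by (auto simp: relcomp_unfold)
qed

text \<open>The successor and the predecessor \<open>(u + 4) mod 5\<close> of \<open>u\<close> have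
  \<open>u\<close> as their only common neighbour.\<close>

lemma cycle5_neighbourhood_inj:
  assumes "u < 5" "v < 5" "\<And>w. (u, w) \<in> parcs (cycle_graph 5) \<Longrightarrow> (v, w) \<in> parcs (cycle_graph 5)"
  shows "u = v"
  using assms(1,2) assms(3)[of "Suc u mod 5"] assms(3)[of "(u + 4) mod 5"]
  unfolding parcs_cycle5 less_5_cases by auto

lemma projective_wheel5: "projective wheel5"
  unfolding projective_def
proof (intro allI impI, elim conjE)
  fix m and f :: "nat option list \<Rightarrow> nat option"
  assume poly: "polymorphism wheel5 m f" and idem: "idempotent wheel5 m f"
  let ?rim = "Some ` {..<5::nat}"
  have arc: "(f xs, f ys) \<in> parcs wheel5"
    if "length xs = m" "length ys = m" "\<And>i. i < m \<Longrightarrow> (xs ! i, ys ! i) \<in> parcs wheel5" for xs ys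
    using poly that by (auto simp: polymorphism_def graph_hom_def direct_power_def)
  have vert: "f xs \<in> pverts wheel5" if "length xs = m" "set xs \<subseteq> pverts wheel5" for xs
    using poly that by (auto simp: polymorphism_def graph_hom_def direct_power_def)
  have const: "f (replicate m v) = v" if "v \<in> pverts wheel5" for v
    using idem that by (auto simp: idempotent_def)
  have rim: "f xs \<in> ?rim" if xs: "length xs = m" "set xs \<subseteq> ?rim" for xs
  proof -
    \<comment> \<open>A rim tuple is adjacent to the constant hub tuple, which idempotency sends to
      the hub.\<close>
    have "(xs ! i, None) \<in> parcs wheel5" if "i < m" for i
      using xs that by (force dest: nth_mem)
    then have "(f xs, f (replicate m None)) \<in> parcs wheel5"
      using xs by (intro arc) auto
    moreover have "f xs \<in> pverts wheel5" using xs by (intro vert) (auto simp: pverts_wheel5)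
    ultimately show ?thesis using const[of None] by (auto simp: pverts_wheel5)
  qed
  have neq: "f xs \<noteq> f ys"
    if xs: "length xs = m" "set xs \<subseteq> ?rim" and ys: "length ys = m" "set ys \<subseteq> ?rim"
      and neq: "\<forall>i<m. xs ! i \<noteq> ys ! i" for xs ys
  proof -
    \<comment> \<open>Coordinatewise rim walks of length three join \<open>xs\<close> to
      \<open>ys\<close>. Their image is such a walk inside the rim, so its ends are
      distinct.\<close>
    have "\<exists>p q. (xs ! i, Some p) \<in> parcs wheel5 \<and> (Some p, Some q) \<in> parcs wheel5 \<and>
        (Some q, ys ! i) \<in> parcs wheel5 \<and> p < 5 \<and> q < 5" if im: "i < m" for i
    proof -
      have "xs ! i \<in> ?rim" "ys ! i \<in> ?rim"
        using im xs ys by (auto intro!: subsetD[OF _ nth_mem])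
      then obtain u v where uv: "xs ! i = Some u" "ys ! i = Some v" "u < 5" "v < 5" "u \<noteq> v"
        using im neq by fastforce
      then obtain p q where pq: "(u, p) \<in> parcs (cycle_graph 5)" "(p, q) \<in> parcs (cycle_graph 5)"
        "(q, v) \<in> parcs (cycle_graph 5)" using cycle5_walk3_iff by metis
      then have "p < 5 \<and> q < 5" by (auto simp: cycle_graph_def)
      then show ?thesis using uv pq by auto
    qed
    then obtain p q where pq: "\<And>i. i < m \<Longrightarrow> (xs ! i, Some (p i)) \<in> parcs wheel5 \<and>
        (Some (p i), Some (q i)) \<in> parcs wheel5 \<and> (Some (q i), ys ! i) \<in> parcs wheel5 \<and>
        p i < 5 \<and> q i < 5" by metis
    let ?p = "map (\<lambda>i. Some (p i)) [0..<m]" and ?q = "map (\<lambda>i. Some (q i)) [0..<m]"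
    have "(f xs, f ?p) \<in> parcs wheel5" "(f ?p, f ?q) \<in> parcs wheel5" "(f ?q, f ys) \<in> parcs wheel5"
      using xs ys pq by (intro arc; simp)+
    moreover have "f xs \<in> ?rim" "f ys \<in> ?rim" "f ?p \<in> ?rim" "f ?q \<in> ?rim"
      using xs ys pq by (intro rim; auto)+
    ultimately show ?thesis using cycle5_walk3_iff by fastforce
  qed
  have "\<exists>i<m. \<forall>xs. length xs = m \<and> set xs \<subseteq> ?rim \<longrightarrow> f xs = xs ! i"
    using rim neq const
    by (intro list_projection_of_neq_preserving[of "Some 0" "Some 1" "Some 2" "Some 3"])
      (auto simp: pverts_wheel5)
  then obtain i where i: "i < m"
    and proj: "\<And>xs. length xs = m \<Longrightarrow> set xs \<subseteq> ?rim \<Longrightarrow> f xs = xs ! i" by blast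
  \<comment> \<open>Choosing a rim neighbour at each coordinate and then overwriting coordinate
    \<open>i\<close> gives a tuple adjacent to \<open>xs\<close> whose \<open>i\<close>-th entry is
    any prescribed neighbour \<open>w\<close> of \<open>xs ! i\<close>. For \<open>w\<close> on the
    rim its value is already known to be \<open>w\<close>.\<close>
  define nb :: "nat option \<Rightarrow> nat option" where
    "nb v = (case v of None \<Rightarrow> Some 0 | Some u \<Rightarrow> Some (Suc u mod 5))" for v
  have nb: "nb v \<in> ?rim" "(v, nb v) \<in> parcs wheel5" if "v \<in> pverts wheel5" for v
    using that unfolding pverts_wheel5 by (auto simp: nb_def, auto simp: cycle_graph_def)
  have nb_arc: "(f xs, f ((map nb xs)[i := w])) \<in> parcs wheel5"
    if "length xs = m" "set xs \<subseteq> pverts wheel5" "(xs ! i, w) \<in> parcs wheel5" for xs w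
    using that i nb(2) nth_mem[of _ xs] by (intro arc) (auto simp: nth_list_update subset_eq)
  have rim_arc: "(f xs, w) \<in> parcs wheel5"
    if xs: "length xs = m" "set xs \<subseteq> pverts wheel5" "(xs ! i, w) \<in> parcs wheel5" and w: "w \<in> ?rim" for xs w
  proof -
    have "set ((map nb xs)[i := w]) \<subseteq> insert w (set (map nb xs))" by (rule set_update_subset_insert)
    also have "\<dots> \<subseteq> ?rim" using xs w nb(1) by auto
    finally have "f ((map nb xs)[i := w]) = w" using xs i proj by simp
    then show ?thesis using nb_arc[OF xs] by simp
  qed
  have hub: "f xs = None" if xs: "length xs = m" "set xs \<subseteq> pverts wheel5" "xs ! i = None" for xs
  proof (cases "f xs")
    \<comment> \<open>The hub is adjacent to every rim vertex, hence so is \<open>f xs\<close>; a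
      rim value \<open>z\<close> would be adjacent to itself.\<close>
    case (Some z)
    then have "z < 5" using vert[OF xs(1,2)] by (auto simp: pverts_wheel5)
    then have "(z, z) \<in> parcs (cycle_graph 5)"
      using rim_arc[OF xs(1,2), of "Some z"] xs(3) Some by auto
    then show ?thesis by (auto simp: parcs_cycle5)
  qed
  have "f xs = xs ! i" if xs: "length xs = m" "set xs \<subseteq> pverts wheel5" for xs
  proof (cases "xs ! i")
    case None
    then show ?thesis using hub xs by simp
  next
    case (Some u)
    then have u: "u < 5" using xs i subsetD[OF xs(2) nth_mem[of i]] by (auto simp: pverts_wheel5)
    \<comment> \<open>This hub-valued neighbour of \<open>xs\<close> forces \<open>f xs\<close> onto
      the rim, where its neighbourhood contains that of \<open>u\<close>.\<close>
    have "f ((map nb xs)[i := None]) = None"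
    proof (rule hub)
      have "set ((map nb xs)[i := None]) \<subseteq> insert None (set (map nb xs))"
        by (rule set_update_subset_insert)
      also have "\<dots> \<subseteq> pverts wheel5" using xs nb(1) by (auto simp: pverts_wheel5)
      finally show "set ((map nb xs)[i := None]) \<subseteq> pverts wheel5" .
    qed (use xs i in auto)
    then have "f xs \<noteq> None" using nb_arc[OF xs, of None] Some u by (cases "f xs") auto
    then obtain z where z: "f xs = Some z" "z < 5" using vert[OF xs] by (auto simp: pverts_wheel5)
    have "(z, w) \<in> parcs (cycle_graph 5)" if "(u, w) \<in> parcs (cycle_graph 5)" for w
    proof -
      have "w < 5" using that by (auto simp: cycle_graph_def)
      then show ?thesis using rim_arc[OF xs, of "Some w"] that Some z by auto
    qed
    then have "u = z" using cycle5_neighbourhood_inj u z by blast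
    then show ?thesis using Some z by simp
  qed
  then show "is_projection wheel5 m f"
    using i by (auto simp: is_projection_def direct_power_def)
qed

section \<open>Endomorphisms of the complete graph and of the wheel\<close>

lemma coreI:
  assumes "finite (pverts H)" and "\<And>f. graph_hom H H f \<Longrightarrow> inj_on f (pverts H)"
  shows "core H"
  unfolding core_def
proof (intro allI impI)
  fix f assume f: "graph_hom H H f"
  then have "f ` pverts H \<subseteq> pverts H" by (auto simp: graph_hom_def)
  then show "bij_betw f (pverts H) (pverts H)"
    using assms f by (simp add: bij_betw_def endo_inj_surj)
qed

lemma core_complete_graph: "core (complete_graph n)"
proof (rule coreI)
  fix f assume f: "graph_hom (complete_graph n) (complete_graph n) f"
  have "f u \<noteq> f v" if "u < n" "v < n" "u \<noteq> v" for u v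
    using f that by (auto simp: graph_hom_def complete_graph_def)
  then show "inj_on f (pverts (complete_graph n))"
    by (auto simp: inj_on_def complete_graph_def)
qed (simp add: complete_graph_def)

text \<open>Once the hub is known to be fixed, its neighbours, the rim vertices, stay on the rim;
  walks of length three then carry distinct rim vertices to distinct ones.\<close>

lemma core_wheel5: "core wheel5"
proof (rule coreI)
  fix f assume f: "graph_hom wheel5 wheel5 f"
  have arc: "(f u, f v) \<in> parcs wheel5" if "(u, v) \<in> parcs wheel5" for u v
    using f that by (auto simp: graph_hom_def)
  have vert: "f v \<in> pverts wheel5" if "v \<in> pverts wheel5" for v
    using f that by (auto simp: graph_hom_def)
  have hub: "f None = None"
  proof (cases "f None")
    case (Some i)
    \<comment> \<open>The neighbourhood of a rim vertex induces a path with the hub in the middle, so the rim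
      would be 2-coloured according to whether a vertex is mapped to the hub.\<close>
    have alternate: "(f (Some u) = None) \<noteq> (f (Some v) = None)" if uv: "(u, v) \<in> parcs (cycle_graph 5)" for u v
    proof -
      have "u < 5" "v < 5" using uv by (auto simp: cycle_graph_def)
      then have "(f None, f (Some u)) \<in> parcs wheel5" "(f (Some v), f None) \<in> parcs wheel5"
        "(f (Some u), f (Some v)) \<in> parcs wheel5"
        using uv by (auto intro!: arc)
      then show ?thesis
        using Some cycle5_walk3_iff[of i i] by (cases "f (Some u)"; cases "f (Some v)") auto
    qed
    have "(f (Some 0) = None) \<noteq> (f (Some 1) = None)" "(f (Some 1) = None) \<noteq> (f (Some 2) = None)"
      "(f (Some 2) = None) \<noteq> (f (Some 3) = None)" "(f (Some 3) = None) \<noteq> (f (Some 4) = None)"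
      "(f (Some 4) = None) \<noteq> (f (Some 0) = None)"
      by (rule alternate; simp add: parcs_cycle5)+
    then show ?thesis by argo
  qed simp
  have rim: "\<exists>v<5. f (Some u) = Some v" if "u < 5" for u
    using arc[of None "Some u"] vert[of "Some u"] that hub by (auto simp: pverts_wheel5)
  have rim_inj: "f (Some u) \<noteq> f (Some v)" if uv: "u < 5" "v < 5" "u \<noteq> v" for u v
  proof -
    obtain p q where pq: "(u, p) \<in> parcs (cycle_graph 5)" "(p, q) \<in> parcs (cycle_graph 5)"
      "(q, v) \<in> parcs (cycle_graph 5)" using cycle5_walk3_iff uv by metis
    then have "p < 5" "q < 5" by (auto simp: cycle_graph_def)
    then obtain u' p' q' v' where im: "f (Some u) = Some u'" "f (Some p) = Some p'"
      "f (Some q) = Some q'" "f (Some v) = Some v'" using rim uv by metis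
    have "(u', p') \<in> parcs (cycle_graph 5)" "(p', q') \<in> parcs (cycle_graph 5)"
      "(q', v') \<in> parcs (cycle_graph 5)"
      using pq[THEN parcs_wheel5(4)[THEN iffD2], THEN arc] im by simp_all
    then have "u' \<noteq> v'" using cycle5_walk3_iff by metis
    then show ?thesis using im by simp
  qed
  show "inj_on f (pverts wheel5)"
  proof (rule inj_onI)
    fix x y assume xy: "x \<in> pverts wheel5" "y \<in> pverts wheel5" "f x = f y"
    show "x = y"
    proof (cases x; cases y)
      fix u v assume "x = Some u" "y = Some v"
      then show ?thesis using xy rim_inj[of u v] by (auto simp: pverts_wheel5)
    next
      fix u assume "x = Some u" "y = None"
      then show ?thesis using xy rim[of u] hub by (auto simp: pverts_wheel5)
    next
      fix v assume "x = None" "y = Some v"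
      then show ?thesis using xy rim[of v] hub by (auto simp: pverts_wheel5)
    qed simp
  qed
qed (simp add: pverts_wheel5)

section \<open>Isomorphisms\<close>

lemma pair_wf_digraph_of_pair_graph: "pair_graph G \<Longrightarrow> pair_wf_digraph G"
proof -
  assume "pair_graph G"
  then interpret pair_graph G .
  show ?thesis by (rule pair_wf_digraph_axioms)
qed

text \<open>The map \<open>\<psi>\<close> starts at \<open>H\<close>, so that a concrete model can
  be labelled by the vertices of \<open>G\<close>; the isomorphism itself is the inverse
  \<open>\<phi>\<close>, acting on arcs end by end.\<close>

lemma digraph_iso_with_projI:
  assumes G: "pair_wf_digraph G" and H: "pair_wf_digraph H"
    and bij: "bij_betw \<psi> (pverts H) (pverts G)"
    and arcs: "\<And>u v. u \<in> pverts H \<Longrightarrow> v \<in> pverts H \<Longrightarrow> (\<psi> u, \<psi> v) \<in> parcs G \<longleftrightarrow> (u, v) \<in> parcs H"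
  shows "digraph_iso (with_proj G) (with_proj H)"
proof -
  define \<phi> where "\<phi> = the_inv_into (pverts H) \<psi>"
  have \<phi>: "bij_betw \<phi> (pverts G) (pverts H)"
    unfolding \<phi>_def using bij by (rule bij_betw_the_inv_into)
  have \<psi>\<phi>: "\<psi> (\<phi> x) = x" "\<phi> x \<in> pverts H" if "x \<in> pverts G" for x
    using that bij \<phi> by (auto simp: \<phi>_def f_the_inv_into_f_bij_betw bij_betw_apply)
  have \<phi>\<psi>: "\<phi> (\<psi> u) = u" "\<psi> u \<in> pverts G" if "u \<in> pverts H" for u
    using that bij by (auto simp: \<phi>_def the_inv_into_f_f bij_betw_def)
  have Gv: "u \<in> pverts G \<and> v \<in> pverts G" if "(u, v) \<in> parcs G" for u v
    using pair_wf_digraph.in_arcsD1[OF G that] pair_wf_digraph.in_arcsD2[OF G that] by simp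
  have Hv: "u \<in> pverts H \<and> v \<in> pverts H" if "(u, v) \<in> parcs H" for u v
    using pair_wf_digraph.in_arcsD1[OF H that] pair_wf_digraph.in_arcsD2[OF H that] by simp
  have im: "map_prod \<phi> \<phi> ` parcs G = parcs H"
  proof
    show "map_prod \<phi> \<phi> ` parcs G \<subseteq> parcs H"
    proof
      fix e assume "e \<in> map_prod \<phi> \<phi> ` parcs G"
      then obtain u v where uv: "e = (\<phi> u, \<phi> v)" "(u, v) \<in> parcs G" by auto
      then show "e \<in> parcs H" using Gv[of u v] \<psi>\<phi> arcs[of "\<phi> u" "\<phi> v"] by simp
    qed
    show "parcs H \<subseteq> map_prod \<phi> \<phi> ` parcs G"
    proof
      fix e assume "e \<in> parcs H"
      then have "e = map_prod \<phi> \<phi> (map_prod \<psi> \<psi> e)" "map_prod \<psi> \<psi> e \<in> parcs G"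
        using Hv \<phi>\<psi> arcs by (cases e; auto)+
      then show "e \<in> map_prod \<phi> \<phi> ` parcs G" by blast
    qed
  qed
  have "inj_on (map_prod \<phi> \<phi>) (parcs G)"
    using Gv \<psi>\<phi> by (intro inj_on_inverseI[of _ "map_prod \<psi> \<psi>"]) auto
  then have "pre_digraph.digraph_isomorphism (with_proj G)
      \<lparr>iso_verts = \<phi>, iso_arcs = map_prod \<phi> \<phi>, iso_head = snd, iso_tail = fst\<rparr>"
    using G \<phi> by (auto simp: pre_digraph.digraph_isomorphism_def wf_digraph_wp_iff bij_betw_def)
  moreover have "with_proj H = app_iso
      \<lparr>iso_verts = \<phi>, iso_arcs = map_prod \<phi> \<phi>, iso_head = snd, iso_tail = fst\<rparr> (with_proj G)"
    using \<phi> im by (simp add: with_proj_def app_iso_def bij_betw_def)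
  ultimately show ?thesis unfolding digraph_iso_def by blast
qed

text \<open>Conjugating an endomorphism of \<open>G\<close> by the isomorphism gives one of
  \<open>H\<close>, which is bijective; conjugating back recovers the original on
  \<open>pverts G\<close>.\<close>

lemma core_digraph_iso:
  assumes iso: "digraph_iso (with_proj G) (with_proj H)" and "core H"
  shows "core G"
  unfolding core_def
proof (intro allI impI)
  fix f assume f: "graph_hom G G f"
  from iso obtain h where h: "pre_digraph.digraph_isomorphism (with_proj G) h"
    and H: "with_proj H = app_iso h (with_proj G)"
    unfolding digraph_iso_def by blast
  let ?\<phi> = "iso_verts h" and ?\<psi> = "the_inv_into (pverts G) (iso_verts h)"
  have inj: "inj_on ?\<phi> (pverts G)"
    using h by (auto simp: pre_digraph.digraph_isomorphism_def)
  have verts: "pverts H = ?\<phi> ` pverts G"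
    using arg_cong[OF H, of verts] by simp
  have G: "pair_wf_digraph G"
    using h by (auto simp: pre_digraph.digraph_isomorphism_def wf_digraph_wp_iff)
  \<comment> \<open>The arc map of an isomorphism is a separate component. It is determined here
    because tails and heads are \<open>fst\<close> and \<open>snd\<close> on both sides.\<close>
  have iso_arcs: "iso_arcs h (u, v) = (?\<phi> u, ?\<phi> v)" if "(u, v) \<in> parcs G" for u v
  proof -
    have "iso_tail h = fst" "iso_head h = snd"
      using arg_cong[OF H, of tail] arg_cong[OF H, of head] by simp_all
    then show ?thesis
      using h that by (fastforce simp: pre_digraph.digraph_isomorphism_def prod_eq_iff)
  qed
  have "parcs H = iso_arcs h ` parcs G"
    using arg_cong[OF H, of arcs] by simp
  also have "\<dots> = map_prod ?\<phi> ?\<phi> ` parcs G"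
    by (rule image_cong) (use iso_arcs in \<open>simp_all add: split_paired_all\<close>)
  finally have arcs: "parcs H = map_prod ?\<phi> ?\<phi> ` parcs G" .
  have Gv: "u \<in> pverts G \<and> v \<in> pverts G" if "(u, v) \<in> parcs G" for u v
    using pair_wf_digraph.in_arcsD1[OF G that] pair_wf_digraph.in_arcsD2[OF G that] by simp
  have \<psi>: "?\<psi> (?\<phi> x) = x" if "x \<in> pverts G" for x
    using inj that by (rule the_inv_into_f_f)
  have "graph_hom H H (?\<phi> \<circ> f \<circ> ?\<psi>)"
    unfolding graph_hom_def
  proof (intro conjI ballI)
    fix v assume "v \<in> pverts H"
    then show "(?\<phi> \<circ> f \<circ> ?\<psi>) v \<in> pverts H"
      using f \<psi> by (auto simp: verts graph_hom_def)
  next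
    fix e assume "e \<in> parcs H"
    then obtain u v where uv: "(u, v) \<in> parcs G" and e: "e = (?\<phi> u, ?\<phi> v)"
      unfolding arcs by auto
    have "(f u, f v) \<in> parcs G" using f uv by (auto simp: graph_hom_def)
    then have "(?\<phi> (f u), ?\<phi> (f v)) \<in> parcs H"
      unfolding arcs by (metis image_eqI map_prod_simp)
    then show "case e of (u, v) \<Rightarrow> ((?\<phi> \<circ> f \<circ> ?\<psi>) u, (?\<phi> \<circ> f \<circ> ?\<psi>) v) \<in> parcs H"
      using Gv[OF uv] \<psi> by (simp add: e)
  qed
  then have bij: "bij_betw (?\<phi> \<circ> f \<circ> ?\<psi>) (pverts H) (pverts H)"
    using \<open>core H\<close> by (simp add: core_def)
  have \<phi>: "bij_betw ?\<phi> (pverts G) (pverts H)"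
    using inj verts by (simp add: bij_betw_def)
  have "bij_betw (?\<psi> \<circ> ((?\<phi> \<circ> f \<circ> ?\<psi>) \<circ> ?\<phi>)) (pverts G) (pverts G)"
    by (rule bij_betw_trans[OF bij_betw_trans[OF \<phi> bij] bij_betw_the_inv_into[OF \<phi>]])
  moreover have "(?\<psi> \<circ> ((?\<phi> \<circ> f \<circ> ?\<psi>) \<circ> ?\<phi>)) x = f x" if "x \<in> pverts G" for x
    using that f \<psi> by (simp add: graph_hom_def)
  ultimately show "bij_betw f (pverts G) (pverts G)"
    using bij_betw_cong[of "pverts G"] by blast
qed

section \<open>Cores with six vertices\<close>

locale core_graph = pair_graph H for H :: "'a pair_pre_digraph" +
  assumes core: "core H"
begin

abbreviation adj :: "'a \<Rightarrow> 'a \<Rightarrow> bool" where "adj u v \<equiv> (u, v) \<in> parcs H"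

lemma adj_sym: "adj u v \<longleftrightarrow> adj v u"
  using pair_sym_arcs by (auto simp: symmetric_def dest: symD)

lemma adj_irrefl: "\<not> adj u u"
  using pair_no_loops[of "(u, u)"] by auto

lemma adj_verts: "adj u v \<Longrightarrow> u \<in> pverts H" "adj u v \<Longrightarrow> v \<in> pverts H"
  by (auto dest: in_arcsD1 in_arcsD2)

lemma no_collapse:
  assumes "\<And>v. v \<in> pverts H \<Longrightarrow> f v \<in> pverts H" and "f ` pverts H \<subset> pverts H"
  shows "\<exists>u v. adj u v \<and> \<not> adj (f u) (f v)"
proof (rule ccontr)
  assume "\<not> ?thesis"
  then have "graph_hom H H f" using assms(1) by (auto simp: graph_hom_def)
  then have "f ` pverts H = pverts H" using core by (simp add: core_def bij_betw_def)
  then show False using assms(2) by simp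
qed

text \<open>Otherwise moving \<open>u\<close> onto \<open>v\<close> and fixing all other vertices
  would be a non-surjective endomorphism.\<close>

lemma no_fold:
  assumes "u \<in> pverts H" "v \<in> pverts H" "u \<noteq> v"
  shows "\<exists>w\<in>pverts H. adj u w \<and> \<not> adj v w"
proof (rule ccontr)
  assume no: "\<not> ?thesis"
  have "\<exists>x y. adj x y \<and> \<not> adj ((id(u := v)) x) ((id(u := v)) y)"
    using assms by (intro no_collapse) auto
  then obtain x y where "adj x y" "\<not> adj ((id(u := v)) x) ((id(u := v)) y)" by blast
  then show False
    using no adj_verts adj_sym adj_irrefl by (simp split: if_splits) blast+
qed

text \<open>Extended by the identity on \<open>K\<close>, the colouring maps \<open>H\<close> into a
  proper subset, so it destroys an edge. In a clique this means that the two ends get the same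
  colour, and the cases record whether one end lies in \<open>K\<close>.\<close>

lemma no_clique_colouring:
  assumes K: "K \<subset> pverts H" "\<And>x y. x \<in> K \<Longrightarrow> y \<in> K \<Longrightarrow> x \<noteq> y \<Longrightarrow> adj x y"
    and c: "\<And>v. v \<in> pverts H - K \<Longrightarrow> c v \<in> K"
  shows "\<exists>u\<in>pverts H - K. adj (c u) u \<or> (\<exists>v\<in>pverts H - K. u \<noteq> v \<and> adj u v \<and> c u = c v)"
proof -
  define f where "f v = (if v \<in> K then v else c v)" for v
  have f: "f v \<in> K" if "v \<in> pverts H" for v using that c by (simp add: f_def)
  have "f ` pverts H \<subset> pverts H"
    by (rule subset_psubset_trans[of _ K]) (use f K in auto)
  then obtain u v where uv: "adj u v" "\<not> adj (f u) (f v)"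
    using no_collapse[of f] f K by blast
  then have eq: "f u = f v" using K(2)[of "f u" "f v"] f adj_verts by blast
  have ne: "u \<noteq> v" using uv adj_irrefl by blast
  have V: "u \<in> pverts H" "v \<in> pverts H" using uv adj_verts by blast+
  show ?thesis
  proof (cases "u \<in> K")
    case True
    then have "v \<notin> K" "c v = u" using eq ne by (auto simp: f_def split: if_splits)
    then show ?thesis using uv V by blast
  next
    case False
    show ?thesis
    proof (cases "v \<in> K")
      case True
      then have "c u = v" using eq False by (simp add: f_def)
      then show ?thesis using uv V False adj_sym by blast
    next
      case v: False
      then have "c u = c v" using eq False by (simp add: f_def)
      then show ?thesis using uv V False v ne by blast
    qed
  qed
qed

section \<open>Enlarging a clique through obstructed colourings\<close>

text \<open>Any obstruction to the constant colouring by a single vertex is an edge.\<close>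

lemma edge_exists:
  assumes "card (pverts H) = 6"
  obtains a b where "adj a b"
proof -
  obtain a where a: "a \<in> pverts H" using assms by fastforce
  have "pverts H \<noteq> {a}" using assms by (intro notI) simp
  then have "{a} \<subset> pverts H" using a by blast
  then have "\<exists>a b. adj a b" using no_clique_colouring[of "{a}" "\<lambda>_. a"] by auto
  then show ?thesis using that by blast
qed

text \<open>With one vertex \<open>w\<close> left over, colouring it by \<open>x\<close> can only be
  blocked by an edge from \<open>x\<close> to \<open>w\<close>.\<close>

lemma K6_if_K5:
  assumes V: "pverts H = {a, b, c, d, e, w}" and dist: "distinct [a, b, c, d, e, w]"
    and K: "adj a b" "adj a c" "adj a d" "adj a e" "adj b c" "adj b d" "adj b e"
      "adj c d" "adj c e" "adj d e"
  shows "adj a w \<and> adj b w \<and> adj c w \<and> adj d w \<and> adj e w"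
proof -
  let ?K = "{a, b, c, d, e}"
  have clique: "adj x y" if "x \<in> ?K" "y \<in> ?K" "x \<noteq> y" for x y
    using that K K[THEN adj_sym[THEN iffD1]] by auto
  have "?K \<subset> pverts H" and rest: "pverts H - ?K = {w}" using V dist by auto
  then have "adj x w" if "x \<in> ?K" for x
    using no_clique_colouring[of ?K "\<lambda>_. x", OF _ clique] that unfolding rest by blast
  then show ?thesis by simp
qed

text \<open>If \<open>u\<close> and \<open>v\<close> both have non-neighbours in the clique, then
  colouring each by one of them is always blocked. This forces \<open>u\<close> and \<open>v\<close>
  to be adjacent with the same single non-neighbour, which they replace in a larger clique.\<close>

lemma K5_if_K4:
  assumes V: "pverts H = {a, b, c, d, u, v}" and dist: "distinct [a, b, c, d, u, v]"
    and K: "adj a b" "adj a c" "adj a d" "adj b c" "adj b d" "adj c d"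
  shows "adj a u \<and> adj b u \<and> adj c u \<and> adj d u \<or> adj a v \<and> adj b v \<and> adj c v \<and> adj d v \<or>
    adj u v \<and> (adj a u \<and> adj b u \<and> adj c u \<and> adj a v \<and> adj b v \<and> adj c v \<or>
      adj a u \<and> adj b u \<and> adj d u \<and> adj a v \<and> adj b v \<and> adj d v \<or>
      adj a u \<and> adj c u \<and> adj d u \<and> adj a v \<and> adj c v \<and> adj d v \<or>
      adj b u \<and> adj c u \<and> adj d u \<and> adj b v \<and> adj c v \<and> adj d v)"
proof -
  let ?K = "{a, b, c, d}"
  have clique: "adj x y" if "x \<in> ?K" "y \<in> ?K" "x \<noteq> y" for x y
    using that K K[THEN adj_sym[THEN iffD1]] by auto
  have sub: "?K \<subset> pverts H" and rest: "pverts H - ?K = {u, v}" using V dist by auto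
  have "adj x u \<or> adj y v \<or> adj u v \<and> x = y" if xy: "x \<in> ?K" "y \<in> ?K" for x y
  proof -
    let ?c = "\<lambda>z. if z = u then x else y"
    have "?c z \<in> ?K" if "z \<in> pverts H - ?K" for z using xy by simp
    from no_clique_colouring[where c = ?c, OF sub clique this] show ?thesis
      unfolding rest using dist adj_sym[of v u] by auto
  qed
  then have "\<forall>x\<in>?K. \<forall>y\<in>?K. adj x u \<or> adj y v \<or> adj u v \<and> x = y" by blast
  \<comment> \<open>Together with \<open>dist\<close> this gives each disequality in both
    orientations, so the equations between colours are decided before the propositional
    step.\<close>
  moreover have "distinct [v, u, d, c, b, a]" using dist by auto
  ultimately show ?thesis using dist by simp sat
qed

text \<open>Spokes, rim edges and missing chords cover all fifteen pairs, each in one orientation,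
  so the labelling determines the graph.\<close>

definition wheel_on :: "'a \<Rightarrow> 'a \<Rightarrow> 'a \<Rightarrow> 'a \<Rightarrow> 'a \<Rightarrow> 'a \<Rightarrow> bool" where
  "wheel_on h p0 p1 p2 p3 p4 \<longleftrightarrow>
    pverts H = {h, p0, p1, p2, p3, p4} \<and> distinct [h, p0, p1, p2, p3, p4] \<and>
    adj h p0 \<and> adj h p1 \<and> adj h p2 \<and> adj h p3 \<and> adj h p4 \<and>
    adj p0 p1 \<and> adj p1 p2 \<and> adj p2 p3 \<and> adj p3 p4 \<and> adj p4 p0 \<and>
    \<not> adj p0 p2 \<and> \<not> adj p1 p3 \<and> \<not> adj p2 p4 \<and> \<not> adj p3 p0 \<and> \<not> adj p4 p1"

text \<open>Take the non-neighbours of an outside vertex in the triangle as its list of colours.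
  Without a clique of size four, list colouring fails only if the outside vertices induce a path
  with lists \<open>{x}\<close>, \<open>{x, y}\<close>, \<open>{y}\<close>.\<close>

lemma wheel_if_no_K4:
  assumes V: "pverts H = {a, b, c, u, v, w}" and dist: "distinct [a, b, c, u, v, w]"
    and K: "adj a b" "adj a c" "adj b c"
    and no_K4: "\<And>p q r s. adj p q \<Longrightarrow> adj p r \<Longrightarrow> adj p s \<Longrightarrow> adj q r \<Longrightarrow> adj q s \<Longrightarrow> \<not> adj r s"
  shows "\<exists>h p0 p1 p2 p3 p4. wheel_on h p0 p1 p2 p3 p4"
proof -
  let ?K = "{a, b, c}"
  have clique: "adj x y" if "x \<in> ?K" "y \<in> ?K" "x \<noteq> y" for x y
    using that K K[THEN adj_sym[THEN iffD1]] by auto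
  have sub: "?K \<subset> pverts H" and rest: "pverts H - ?K = {u, v, w}" using V dist by auto
  have "adj x u \<or> adj y v \<or> adj z w \<or> adj u v \<and> x = y \<or> adj u w \<and> x = z \<or> adj v w \<and> y = z"
    if xyz: "x \<in> ?K" "y \<in> ?K" "z \<in> ?K" for x y z
  proof -
    let ?c = "\<lambda>t. if t = u then x else if t = v then y else z"
    have "?c t \<in> ?K" if "t \<in> pverts H - ?K" for t using xyz by simp
    from no_clique_colouring[where c = ?c, OF sub clique this] show ?thesis
      unfolding rest using dist adj_sym[of v u] adj_sym[of w u] adj_sym[of w v] by auto
  qed
  then have colour: "\<forall>x\<in>?K. \<forall>y\<in>?K. \<forall>z\<in>?K. adj x u \<or> adj y v \<or> adj z w \<or>
      adj u v \<and> x = y \<or> adj u w \<and> x = z \<or> adj v w \<and> y = z" by blast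
  \<comment> \<open>The three facts are Hall-type bounds: the lists of adjacent outside vertices
    cover at least two colours, those of an outside triangle cover all three, and no list is
    empty.\<close>
  have K4: "\<not> (adj x p \<and> adj y p \<and> adj x q \<and> adj y q \<and> adj p q)"
      if "x \<in> ?K" "y \<in> ?K" "x \<noteq> y" for x y p q
    using no_K4[of x y p q] clique that by blast
  have K4': "\<not> (adj x u \<and> adj x v \<and> adj x w \<and> adj u v \<and> adj u w \<and> adj v w)" for x
    using no_K4[of x u v w] by blast
  have K4'': "\<not> (adj a p \<and> adj b p \<and> adj c p)" for p
    using no_K4[of a b c p] K by blast
  \<comment> \<open>\<open>x\<close> and \<open>y\<close> are the only admissible colours of \<open>p\<close> and \<open>r\<close>, and both are admissible for \<open>q\<close>.\<close>
  define P where "P p q r x y z \<longleftrightarrow> adj p q \<and> adj q r \<and> \<not> adj p r \<and>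
    \<not> adj x p \<and> adj y p \<and> adj z p \<and> \<not> adj x q \<and> \<not> adj y q \<and> adj z q \<and>
    adj x r \<and> \<not> adj y r \<and> adj z r" for p q r x y z
  \<comment> \<open>The third colour \<open>z\<close> is in no list, so it is the hub; the five
    negative conditions in \<open>P\<close> are the chords of the rim.\<close>
  have wheel: "wheel_on z p q r x y"
    if "P p q r x y z" "{x, y, z} = ?K" "{p, q, r} = {u, v, w}" "distinct [x, y, z, p, q, r]" for p q r x y z
  proof -
    have "pverts H = {x, y, z} \<union> {p, q, r}" using V that by auto
    moreover have "adj z x" "adj z y" "adj x y" using that by (auto intro!: clique)
    ultimately show ?thesis
      using that adj_sym[of r x] adj_sym[of q x] adj_sym[of r y]
      unfolding wheel_on_def P_def by auto
  qed
  \<comment> \<open>Every colour in the list of the middle vertex must be the only colour of one of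
    its neighbours. The six cases are the ways to name the triangle.\<close>
  have pathP: "\<exists>x y z. P p q r x y z \<and> {x, y, z} = ?K \<and> distinct [x, y, z]"
    if "adj p q" "adj q r" "\<not> adj p r"
      and "\<forall>x\<in>?K. \<forall>y\<in>?K. \<forall>z\<in>?K. adj x p \<or> adj y q \<or> adj z r \<or> x = y \<or> y = z" for p q r
  proof -
    have "distinct [c, b, a]" using dist by auto
    then have "P p q r a b c \<or> P p q r b a c \<or> P p q r a c b \<or> P p q r c a b \<or> P p q r b c a \<or> P p q r c b a"
      unfolding P_def using that dist
        K4[of a b p q] K4[of a c p q] K4[of b c p q] K4[of a b q r] K4[of a c q r] K4[of b c q r]
        K4''[of p] K4''[of q] K4''[of r]
      by simp sat
    then show ?thesis
      using dist insert_commute[of a b "{c}"] insert_commute[of b c] insert_commute[of a c]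
      by (elim disjE) (rule exI, rule exI, rule exI, rule conjI, assumption, force)+
  qed
  have "distinct [c, b, a]" using dist by auto
  \<comment> \<open>With at most one outside edge the lists can be coloured directly, and for three
    edges Hall's condition holds; exactly two edges remain.\<close>
  then have "adj u v \<and> adj v w \<and> \<not> adj u w \<or> adj v u \<and> adj u w \<and> \<not> adj v w \<or>
      adj u w \<and> adj w v \<and> \<not> adj u v"
    using dist colour K4'[of a] K4'[of b] K4'[of c] K4''[of u] K4''[of v] K4''[of w]
      K4[of a b u v] K4[of a c u v] K4[of b c u v] K4[of a b v w] K4[of a c v w] K4[of b c v w]
      K4[of a b u w] K4[of a c u w] K4[of b c u w]
    by (simp add: adj_sym[of v u] adj_sym[of w v]) sat
  then have "\<exists>p q r. (\<exists>x y z. P p q r x y z \<and> {x, y, z} = ?K \<and> distinct [x, y, z]) \<and>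
      {p, q, r} = {u, v, w}"
  proof (elim disjE conjE)
    assume "adj u v" "adj v w" "\<not> adj u w"
    then show ?thesis using pathP[of u v w] colour by blast
  next
    assume "adj v u" "adj u w" "\<not> adj v w"
    then show ?thesis using pathP[of v u w] colour by blast
  next
    assume "adj u w" "adj w v" "\<not> adj u v"
    then show ?thesis using pathP[of u w v] colour by blast
  qed
  then obtain p q r x y z where *: "P p q r x y z" "{x, y, z} = ?K" "distinct [x, y, z]"
    "{p, q, r} = {u, v, w}" by blast
  have "card {p, q, r} = 3" "{x, y, z} \<inter> {p, q, r} = {}" using *(2,4) dist by auto
  then have "distinct [x, y, z, p, q, r]" using *(3) by (auto simp: card_insert_if split: if_splits)
  then show ?thesis using wheel * by blast
qed

text \<open>Having no colouring by an edge means not being bipartite, so without triangles there is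
  a 5-cycle. The sixth vertex then has at most two neighbours on it, all adjacent to a common cycle
  vertex, contradicting \<open>no_fold\<close>. The proof checks this propositionally.\<close>

lemma triangle_exists:
  assumes V: "pverts H = {a, b, u, v, w, x}" and dist: "distinct [a, b, u, v, w, x]"
    and K: "adj a b"
  obtains p q r where "adj p q" "adj p r" "adj q r"
proof -
  let ?K = "{a, b}"
  have clique: "adj x y" if "x \<in> ?K" "y \<in> ?K" "x \<noteq> y" for x y
    using that K K[THEN adj_sym[THEN iffD1]] by auto
  have rev_dist: "distinct [x, w, v, u, b, a]" using dist by auto
  have sub: "?K \<subset> pverts H" and rest: "pverts H - ?K = {u, v, w, x}" using V dist by auto
  have "adj p u \<or> adj q v \<or> adj r w \<or> adj s x \<or> adj u v \<and> p = q \<or> adj u w \<and> p = r \<or>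
      adj u x \<and> p = s \<or> adj v w \<and> q = r \<or> adj v x \<and> q = s \<or> adj w x \<and> r = s"
    if pqrs: "p \<in> ?K" "q \<in> ?K" "r \<in> ?K" "s \<in> ?K" for p q r s
  proof -
    let ?c = "\<lambda>t. if t = u then p else if t = v then q else if t = w then r else s"
    have "?c t \<in> ?K" if "t \<in> pverts H - ?K" for t using pqrs by simp
    from no_clique_colouring[where c = ?c, OF sub clique this] show ?thesis
      unfolding rest using dist rev_dist
      by (simp add: adj_irrefl adj_sym[of v u] adj_sym[of w u] adj_sym[of w v]
        adj_sym[of x u] adj_sym[of x v] adj_sym[of x w] eq_commute[of q p] eq_commute[of r p]
        eq_commute[of s p] eq_commute[of r q] eq_commute[of s q] eq_commute[of s r]) sat
  qed
  then have col: "\<forall>p\<in>?K. \<forall>q\<in>?K. \<forall>r\<in>?K. \<forall>s\<in>?K.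
      adj p u \<or> adj q v \<or> adj r w \<or> adj s x \<or> adj u v \<and> p = q \<or> adj u w \<and> p = r \<or>
      adj u x \<and> p = s \<or> adj v w \<and> q = r \<or> adj v x \<and> q = s \<or> adj w x \<and> r = s" by blast
  have fold: "\<forall>p\<in>pverts H. \<forall>q\<in>pverts H. p = q \<or> (\<exists>r\<in>pverts H. adj p r \<and> \<not> adj q r)"
    using no_fold by blast
  \<comment> \<open>One orientation per pair leaves fifteen propositional variables; below,
    \<open>tri\<close> is instantiated at all twenty triples.\<close>
  have sym: "adj b a = adj a b" "adj u a = adj a u" "adj v a = adj a v" "adj w a = adj a w" "adj x a = adj a x"
    "adj u b = adj b u" "adj v b = adj b v" "adj w b = adj b w" "adj x b = adj b x" "adj v u = adj u v"
    "adj w u = adj u w" "adj x u = adj u x" "adj w v = adj v w" "adj x v = adj v x" "adj x w = adj w x"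
    by (rule adj_sym)+
  have "\<exists>p q r. adj p q \<and> adj p r \<and> adj q r"
  proof (rule ccontr)
    assume "\<not> ?thesis"
    then have tri: "\<not> (adj p q \<and> adj p r \<and> adj q r)" for p q r by blast
    show False
      using K dist rev_dist col fold
        tri[of a b u] tri[of a b v] tri[of a b w] tri[of a b x] tri[of a u v]
        tri[of a u w] tri[of a u x] tri[of a v w] tri[of a v x] tri[of a w x]
        tri[of b u v] tri[of b u w] tri[of b u x] tri[of b v w] tri[of b v x]
        tri[of b w x] tri[of u v w] tri[of u v x] tri[of u w x] tri[of v w x]
      unfolding V by (simp add: adj_irrefl sym) sat
  qed
  then show ?thesis using that by blast
qed

lemma complete_or_wheel:
  assumes card: "card (pverts H) = 6"
  shows "(\<forall>x\<in>pverts H. \<forall>y\<in>pverts H. x \<noteq> y \<longrightarrow> adj x y) \<or>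
    (\<exists>h p0 p1 p2 p3 p4. wheel_on h p0 p1 p2 p3 p4)"
proof (rule disjCI)
  assume no_wheel: "\<not> (\<exists>h p0 p1 p2 p3 p4. wheel_on h p0 p1 p2 p3 p4)"
  \<comment> \<open>Names the vertices outside the current clique, as each enlargement lemma expects
    an explicit list of all six.\<close>
  have complete_list: "\<exists>rs. length rs = 6 - length ks \<and> distinct (ks @ rs) \<and> set (ks @ rs) = pverts H"
    if "distinct ks" "set ks \<subseteq> pverts H" for ks
  proof -
    obtain rs where "set rs = pverts H - set ks" "distinct rs"
      using finite_distinct_list[of "pverts H - set ks"] by auto
    moreover have "card (pverts H - set ks) = 6 - length ks"
      using that card by (simp add: card_Diff_subset distinct_card)
    ultimately show ?thesis using that by (intro exI[of _ rs]) (auto simp flip: distinct_card)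
  qed
  have neq: "x \<noteq> y" if "adj x y" for x y using that adj_irrefl by blast
  obtain a b where ab: "adj a b" using edge_exists[OF card] .
  obtain a b c where abc: "adj a b" "adj a c" "adj b c"
  proof -
    obtain rs where "length rs = 4" "distinct ([a, b] @ rs)" "set ([a, b] @ rs) = pverts H"
      using complete_list[of "[a, b]"] neq[OF ab] adj_verts ab by auto
    then obtain u v w x where "distinct [a, b, u, v, w, x]" "pverts H = {a, b, u, v, w, x}"
      by (auto simp: numeral_eq_Suc length_Suc_conv)
    then show thesis using triangle_exists ab that by metis
  qed
  have "\<exists>a b c d. adj a b \<and> adj a c \<and> adj a d \<and> adj b c \<and> adj b d \<and> adj c d"
  proof (rule ccontr)
    assume no: "\<not> ?thesis"
    obtain rs where "length rs = 3" "distinct ([a, b, c] @ rs)" "set ([a, b, c] @ rs) = pverts H"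
      using complete_list[of "[a, b, c]"] abc[THEN neq] adj_verts abc by auto
    then obtain u v w where "distinct [a, b, c, u, v, w]" "pverts H = {a, b, c, u, v, w}"
      by (auto simp: numeral_eq_Suc length_Suc_conv)
    then show False using wheel_if_no_K4[of a b c u v w] abc no_wheel no by blast
  qed
  then obtain a b c d where abcd: "adj a b" "adj a c" "adj a d" "adj b c" "adj b d" "adj c d" by blast
  obtain a b c d e where abcde: "adj a b" "adj a c" "adj a d" "adj a e" "adj b c" "adj b d" "adj b e"
      "adj c d" "adj c e" "adj d e"
  proof -
    obtain rs where "length rs = 2" "distinct ([a, b, c, d] @ rs)" "set ([a, b, c, d] @ rs) = pverts H"
      using complete_list[of "[a, b, c, d]"] abcd[THEN neq] adj_verts abcd by auto
    then obtain u v where "distinct [a, b, c, d, u, v]" "pverts H = {a, b, c, d, u, v}"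
      by (auto simp: numeral_eq_Suc length_Suc_conv)
    from K5_if_K4[OF this(2,1) abcd] show thesis
      using abcd by (elim disjE conjE) (rule that; assumption)+
  qed
  obtain rs where "length rs = 1" "distinct ([a, b, c, d, e] @ rs)" "set ([a, b, c, d, e] @ rs) = pverts H"
    using complete_list[of "[a, b, c, d, e]"] abcde[THEN neq] adj_verts abcde by auto
  then obtain w where V: "distinct [a, b, c, d, e, w]" "pverts H = {a, b, c, d, e, w}"
    by (auto simp: numeral_eq_Suc length_Suc_conv)
  have "adj a w" "adj b w" "adj c w" "adj d w" "adj e w"
    using K6_if_K5[OF V(2,1) abcde] by simp_all
  note K6 = abcde this
  show "\<forall>x\<in>pverts H. \<forall>y\<in>pverts H. x \<noteq> y \<longrightarrow> adj x y"
    unfolding V using K6 K6[THEN adj_sym[THEN iffD1]] by simp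
qed

end

section \<open>Explicit isomorphisms with the two models\<close>

lemma (in core_graph) digraph_iso_complete_graph:
  assumes "card (pverts H) = n" and complete: "\<forall>x\<in>pverts H. \<forall>y\<in>pverts H. x \<noteq> y \<longrightarrow> adj x y"
  shows "digraph_iso (with_proj H) (with_proj (complete_graph n))"
proof -
  obtain \<psi> where \<psi>: "bij_betw \<psi> {..<n} (pverts H)"
    using ex_bij_betw_nat_finite[of "pverts H"] assms(1) by (auto simp: atLeast0LessThan)
  show ?thesis
  proof (rule digraph_iso_with_projI)
    show "bij_betw \<psi> (pverts (complete_graph n)) (pverts H)"
      using \<psi> by (simp add: complete_graph_def)
    fix u v assume uv: "u \<in> pverts (complete_graph n)" "v \<in> pverts (complete_graph n)"
    then have "\<psi> u \<in> pverts H" "\<psi> v \<in> pverts H" "\<psi> u = \<psi> v \<longleftrightarrow> u = v"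
      using \<psi> by (auto simp: complete_graph_def bij_betw_def inj_on_def)
    then show "adj (\<psi> u) (\<psi> v) \<longleftrightarrow> (u, v) \<in> parcs (complete_graph n)"
      using uv complete adj_irrefl by (auto simp: complete_graph_def)
  qed (rule pair_wf_digraph_axioms pair_wf_digraph_of_pair_graph pair_graph_complete_graph)+
qed

lemma (in core_graph) digraph_iso_wheel5:
  assumes "wheel_on h p0 p1 p2 p3 p4"
  shows "digraph_iso (with_proj H) (with_proj wheel5)"
proof -
  define \<psi> where "\<psi> = case_option h (\<lambda>i. [p0, p1, p2, p3, p4] ! i)"
  have [simp]: "\<psi> None = h" "\<psi> (Some 0) = p0" "\<psi> (Some 1) = p1" "\<psi> (Some (Suc 0)) = p1" "\<psi> (Some 2) = p2"
    "\<psi> (Some 3) = p3" "\<psi> (Some 4) = p4" by (simp_all add: \<psi>_def)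
  have W: "pverts wheel5 = {None, Some 0, Some 1, Some 2, Some 3, Some 4}"
    by (auto simp: pverts_wheel5 less_5_cases)
  have arcs: "adj h p0" "adj h p1" "adj h p2" "adj h p3" "adj h p4"
      "adj p0 p1" "adj p1 p2" "adj p2 p3" "adj p3 p4" "adj p4 p0"
    and nonarcs: "\<not> adj p0 p2" "\<not> adj p1 p3" "\<not> adj p2 p4" "\<not> adj p3 p0" "\<not> adj p4 p1"
    and V: "pverts H = {h, p0, p1, p2, p3, p4}" "distinct [h, p0, p1, p2, p3, p4]"
    using assms unfolding wheel_on_def by simp_all
  have nonarcs_sym: "\<not> adj p2 p0" "\<not> adj p3 p1" "\<not> adj p4 p2" "\<not> adj p0 p3" "\<not> adj p1 p4"
    using nonarcs adj_sym by blast+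
  show ?thesis
  proof (rule digraph_iso_with_projI)
    show "bij_betw \<psi> (pverts wheel5) (pverts H)"
    proof (rule bij_betw_imageI)
      show image: "\<psi> ` pverts wheel5 = pverts H" unfolding W V(1) by simp
      \<comment> \<open>Both sides have six vertices, so surjectivity of the labelling yields
        injectivity.\<close>
      have "card (pverts H) = 6" unfolding V(1) using V(2) by simp
      then have "card (\<psi> ` pverts wheel5) = card (pverts wheel5)" by (simp add: image, simp add: W)
      then show "inj_on \<psi> (pverts wheel5)" by (intro eq_card_imp_inj_on) (simp_all add: W)
    qed
    fix u v assume "u \<in> pverts wheel5" "v \<in> pverts wheel5"
    then show "adj (\<psi> u) (\<psi> v) \<longleftrightarrow> (u, v) \<in> parcs wheel5"
      unfolding W
      by (elim insertE emptyE)
        (simp_all add: parcs_cycle5 adj_irrefl arcs arcs[THEN adj_sym[THEN iffD1]]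
          nonarcs nonarcs_sym)
  qed (rule pair_wf_digraph_axioms pair_wf_digraph_of_pair_graph pair_graph_add_universal_vertex
      pair_graph_cycle_graph | simp)+
qed

theorem theorem5p7:
  shows "(\<forall>H :: 'a pair_pre_digraph. pair_graph H \<and> card (pverts H) = 6 \<longrightarrow>
            (core H \<longleftrightarrow>
               digraph_iso (with_proj H) (with_proj (complete_graph 6)) \<or>
               digraph_iso (with_proj H) (with_proj (add_universal_vertex (cycle_graph 5))))) \<and>
         core (complete_graph 6) \<and>
         core (add_universal_vertex (cycle_graph 5)) \<and>
         projective (complete_graph 6) \<and>
         projective (add_universal_vertex (cycle_graph 5))"
proof (intro conjI allI impI)
  fix H :: "'a pair_pre_digraph" assume H: "pair_graph H \<and> card (pverts H) = 6"
  show "core H \<longleftrightarrow> digraph_iso (with_proj H) (with_proj (complete_graph 6)) \<or>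
      digraph_iso (with_proj H) (with_proj wheel5)"
  proof
    assume "core H"
    with H interpret core_graph H by (simp add: core_graph_def core_graph_axioms_def)
    show "digraph_iso (with_proj H) (with_proj (complete_graph 6)) \<or>
        digraph_iso (with_proj H) (with_proj wheel5)"
      using complete_or_wheel[OF conjunct2[OF H]]
      by (elim disjE exE) (simp_all add: digraph_iso_complete_graph digraph_iso_wheel5 H)
  next
    assume "digraph_iso (with_proj H) (with_proj (complete_graph 6)) \<or>
      digraph_iso (with_proj H) (with_proj wheel5)"
    then show "core H"
    proof
      assume "digraph_iso (with_proj H) (with_proj (complete_graph 6))"
      then show ?thesis using core_complete_graph by (rule core_digraph_iso)
    next
      assume "digraph_iso (with_proj H) (with_proj wheel5)"
      then show ?thesis using core_wheel5 by (rule core_digraph_iso)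
    qed
  qed
qed (simp_all add: core_complete_graph core_wheel5 projective_complete_graph projective_wheel5)

end
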